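(* Let $K$ be a compact metric space, let $F$ be a closed subspace of $K$ and let $f$ be a Baire-1 function on $F$. Then there exists a Baire-1 function $g$ on $K$ such that $g|_F=f$ and $\beta_K(g)=\beta_F(f)$.
   Context: A function on a compact metric space is Baire-1 if it is the pointwise limit of a sequence of real-valued continuous functions. Oscillation index. Let $H$ be a compact metric space, $f$ a real-valued function whose domain contains $H$, and $\varepsilon>0$. Put $H^0(f,\varepsilon)=H$. For a countable ordinal $\alpha$, $H^{\alpha+1}(f,\varepsilon)$ is the set of all $x\in H^\alpha(f,\varepsilon)$ such that for every open set $U$ containing $x$ there are $x_1,x_2\in U\cap H^\alpha(f,\varepsilon)$ with $|f(x_1)-f(x_2)|\ge\varepsilon$. For a countable limit ordinal $\alpha$, $H^\alpha(f,\varepsilon)=\bigcap_{\alpha'<\alpha}H^{\alpha'}(f,\varepsilon)$. Let $\beta_H(f,\varepsilon)$ be the least countable $\alpha$ with $H^\alpha(f,\varepsilon)=\emptyset$ if such $\alpha$ exists, and $\omega_1$ otherwise; $\beta_H(f)=\sup_{\varepsilon>0}\beta_H(f,\varepsilon)$.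
   Formalization: The closed subspace F is assumed nonempty unless K is empty; for F empty and K nonempty the claim fails, since the index of f on F is 0 while every g on K has index at least 1. *)

theory Defs
  imports "HOL-Analysis.Analysis" "HOL-Library.Countable_Set_Type"
begin

unbundle cardinal_syntax

section \<open>The ordinals up to and including the first uncountable one\<close>

text \<open>
  An ordinal is an order type of well-orders. In the theory of cardinals of Main, a well-order is
  the (reflexive) relation \<open>r\<close> with underlying set \<open>Field r\<close>, \<open>=o\<close> is isomorphism and \<open>\<le>o\<close> is
  embeddability as an initial segment. The successor cardinal \<open>cardSuc natLeq\<close> of \<open>natLeq\<close> is a
  well-order of type \<open>\<omega>\<^sub>1\<close>, living on the type \<open>nat set\<close>. The type below therefore contains exactly
  the ordinals \<open>\<le> \<omega>\<^sub>1\<close>.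
\<close>

definition wo_iso :: "nat set rel \<Rightarrow> nat set rel \<Rightarrow> bool"
  where "wo_iso r s \<longleftrightarrow> r \<le>o cardSuc natLeq \<and> s \<le>o cardSuc natLeq \<and> r =o s"

lemma Well_order_cardSuc_natLeq: "Well_order (cardSuc natLeq)"
  using cardSuc_Card_order[OF natLeq_Card_order] unfolding card_order_on_def by blast

lemma part_equivp_wo_iso: "part_equivp wo_iso"
proof (rule part_equivpI)
  show "\<exists>r. wo_iso r r"
    unfolding wo_iso_def
    using Well_order_cardSuc_natLeq ordIso_reflexive ordLeq_reflexive by blast
  show "symp wo_iso"
    unfolding wo_iso_def symp_def using ordIso_symmetric by blast
  show "transp wo_iso"
    unfolding wo_iso_def transp_def using ordIso_transitive by blast
qed

quotient_type omega1_ord = "nat set rel" / partial: wo_iso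
  by (rule part_equivp_wo_iso)

instantiation omega1_ord :: wellorder
begin

lift_definition less_eq_omega1_ord :: "omega1_ord \<Rightarrow> omega1_ord \<Rightarrow> bool" is "\<lambda>r s. r \<le>o s"
  unfolding wo_iso_def
  by (metis ordIso_ordLeq_trans ordIso_symmetric ordLeq_ordIso_trans)

lift_definition less_omega1_ord :: "omega1_ord \<Rightarrow> omega1_ord \<Rightarrow> bool" is "\<lambda>r s. r <o s"
  unfolding wo_iso_def
  by (metis ordIso_ordLess_trans ordIso_symmetric ordLess_ordIso_trans)

instance
proof
  fix x y z :: omega1_ord
  show "(x < y) = (x \<le> y \<and> \<not> y \<le> x)"
    by transfer (metis wo_iso_def not_ordLess_ordLeq not_ordLeq_iff_ordLess ordLeq_Well_order_simp
        ordLess_imp_ordLeq)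
  show "x \<le> x"
    by transfer (metis wo_iso_def ordLeq_Well_order_simp ordLeq_reflexive)
  show "x \<le> z" if "x \<le> y" "y \<le> z"
    using that by transfer (metis ordLeq_transitive)
  show "x = y" if "x \<le> y" "y \<le> x"
    using that by transfer (metis wo_iso_def ordIso_iff_ordLeq)
  show "x \<le> y \<or> y \<le> x"
    by transfer (metis wo_iso_def ordLeq_Well_order_simp ordLeq_total)
next
  fix P :: "omega1_ord \<Rightarrow> bool" and a
  assume step: "\<And>x. (\<And>y. y < x \<Longrightarrow> P y) \<Longrightarrow> P x"
  have "wf {(x::omega1_ord, y). x < y}"
  proof (rule wf_subset[OF wf_inv_image[OF wf_ordLess, of rep_omega1_ord]])
    show "{(x, y). x < y} \<subseteq> inv_image ordLess rep_omega1_ord"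
      unfolding less_omega1_ord_def by (auto simp: inv_image_def)
  qed
  then show "P a"
    by (rule wf_induct) (use step in blast)
qed

end

definition ord_omega1 :: omega1_ord
  where "ord_omega1 = abs_omega1_ord (cardSuc natLeq)"

definition ord_zero :: omega1_ord
  where "ord_zero = abs_omega1_ord {}"

lemma abs_omega1_ord_less_iff:
  assumes "r \<le>o cardSuc natLeq" "s \<le>o cardSuc natLeq"
  shows "abs_omega1_ord r < abs_omega1_ord s \<longleftrightarrow> r <o s"
proof (rule less_omega1_ord.abs_eq)
  show "wo_iso r r" "wo_iso s s"
    using assms ordLeq_Well_order_simp ordIso_reflexive unfolding wo_iso_def by blast+
qed

lemma ord_le_omega1: "x \<le> ord_omega1"
proof -
  have "wo_iso (cardSuc natLeq) (cardSuc natLeq)"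
    unfolding wo_iso_def
    using Well_order_cardSuc_natLeq ordIso_reflexive ordLeq_reflexive by blast
  moreover obtain r where "wo_iso r r" "x = abs_omega1_ord r"
    by (metis Quotient_omega1_ord Quotient_def)
  ultimately show ?thesis
    unfolding ord_omega1_def by (simp add: less_eq_omega1_ord.abs_eq) (simp add: wo_iso_def)
qed

text \<open>The elements below \<open>ord_omega1\<close> are precisely the countable ordinals.\<close>

lemma less_ord_omega1_iff_countable:
  assumes "Well_order (r :: nat set rel)" "r \<le>o cardSuc natLeq"
  shows "abs_omega1_ord r < ord_omega1 \<longleftrightarrow> countable (Field r)"
proof -
  have c: "Well_order (cardSuc natLeq)" "Card_order (cardSuc natLeq)"
    using Well_order_cardSuc_natLeq cardSuc_Card_order[OF natLeq_Card_order] by auto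
  have "r <o cardSuc natLeq \<longleftrightarrow> |Field r| <o cardSuc natLeq"
  proof
    assume "r <o cardSuc natLeq"
    then show "|Field r| <o cardSuc natLeq"
      using card_of_least[of "Field r" r] assms(1) ordLeq_ordLess_trans by blast
  next
    assume *: "|Field r| <o cardSuc natLeq"
    show "r <o cardSuc natLeq"
    proof (rule ccontr)
      assume "\<not> r <o cardSuc natLeq"
      then have "cardSuc natLeq \<le>o r"
        using assms(1) c not_ordLess_iff_ordLeq by blast
      then have "|Field (cardSuc natLeq)| \<le>o |Field r|"
        using card_of_mono2 by blast
      then have "cardSuc natLeq \<le>o |Field r|"
        using card_of_Field_ordIso[OF c(2)] ordIso_ordLeq_trans ordIso_symmetric by blast
      then show False using * not_ordLess_ordLeq by blast
    qed
  qed
  also have "\<dots> \<longleftrightarrow> countable (Field r)"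
    using cardSuc_ordLeq_ordLess[OF natLeq_Card_order card_of_Card_order]
    by (simp add: countable_card_le_natLeq)
  finally show ?thesis
    unfolding ord_omega1_def
    using abs_omega1_ord_less_iff assms(2) ordLeq_reflexive[OF c(1)] by blast
qed

lemma ord_zero_le: "ord_zero \<le> x"
proof -
  have e: "({} :: nat set rel) \<le>o r" if "Well_order r" for r :: "nat set rel"
  proof -
    have "Field |{} :: nat set set| = {}"
      by (rule Field_card_of)
    then have "|{} :: nat set set| = {}"
      by (auto simp: Field_def)
    moreover have "|{} :: nat set set| \<le>o r"
      using card_of_empty1 that by blast
    ultimately show ?thesis by simp
  qed
  obtain r where "wo_iso r r" "x = abs_omega1_ord r"
    by (metis Quotient_omega1_ord Quotient_def)
  moreover have "wo_iso {} {}"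
    unfolding wo_iso_def using e[OF Well_order_cardSuc_natLeq] ordLeq_Well_order_simp
      ordIso_reflexive by blast
  ultimately show ?thesis
    unfolding ord_zero_def by (simp add: less_eq_omega1_ord.abs_eq)
      (use e ordLeq_Well_order_simp in \<open>auto simp: wo_iso_def\<close>)
qed

unbundle no cardinal_syntax

instantiation omega1_ord :: complete_linorder
begin

definition bot_omega1_ord :: omega1_ord where "bot = ord_zero"
definition top_omega1_ord :: omega1_ord where "top = ord_omega1"
definition inf_omega1_ord :: "omega1_ord \<Rightarrow> omega1_ord \<Rightarrow> omega1_ord" where "inf x y = min x (y :: omega1_ord)"
definition sup_omega1_ord :: "omega1_ord \<Rightarrow> omega1_ord \<Rightarrow> omega1_ord" where "sup x y = max x (y :: omega1_ord)"
definition Sup_omega1_ord :: "omega1_ord set \<Rightarrow> omega1_ord"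
  where "Sup A = (LEAST b :: omega1_ord. \<forall>a\<in>A. a \<le> b)"
definition Inf_omega1_ord :: "omega1_ord set \<Rightarrow> omega1_ord"
  where "Inf A = (if (A :: omega1_ord set) = {} then ord_omega1 else (LEAST a. a \<in> A))"

instance
proof
  fix x y z :: omega1_ord and A :: "omega1_ord set"
  show "inf x y \<le> x" "inf x y \<le> y" "x \<le> sup x y" "y \<le> sup x y"
    by (auto simp: inf_omega1_ord_def sup_omega1_ord_def)
  show "x \<le> y \<Longrightarrow> x \<le> z \<Longrightarrow> x \<le> inf y z" "y \<le> x \<Longrightarrow> z \<le> x \<Longrightarrow> sup y z \<le> x"
    by (auto simp: inf_omega1_ord_def sup_omega1_ord_def)
  show "Inf A \<le> x" if "x \<in> A"
    using that by (auto simp: Inf_omega1_ord_def intro: Least_le)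
  show "z \<le> Inf A" if "\<And>x. x \<in> A \<Longrightarrow> z \<le> x"
    using that by (auto simp: Inf_omega1_ord_def ord_le_omega1 intro: LeastI2_wellorder)
  have ub: "\<forall>a\<in>A. a \<le> Sup A"
    unfolding Sup_omega1_ord_def by (rule LeastI_ex) (use ord_le_omega1 in blast)
  show "x \<le> Sup A" if "x \<in> A"
    using ub that by blast
  show "Sup A \<le> z" if "\<And>x. x \<in> A \<Longrightarrow> x \<le> z"
    unfolding Sup_omega1_ord_def using that by (auto intro: Least_le)
  show "Inf ({} :: omega1_ord set) = top"
    by (simp add: Inf_omega1_ord_def top_omega1_ord_def)
  show "Sup ({} :: omega1_ord set) = bot"
    unfolding Sup_omega1_ord_def bot_omega1_ord_def
    by (rule Least_equality) (auto simp: ord_zero_le)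
qed

end

text \<open>The successor \<open>\<alpha> + 1\<close>; only meaningful for \<open>\<alpha> < ord_omega1\<close>.\<close>

definition ord_suc :: "omega1_ord \<Rightarrow> omega1_ord"
  where "ord_suc \<alpha> = (LEAST \<beta>. \<alpha> < \<beta>)"

lemma less_ord_suc: "\<alpha> < ord_omega1 \<Longrightarrow> \<alpha> < ord_suc \<alpha>"
  unfolding ord_suc_def by (rule LeastI)

lemma ord_suc_le: "\<alpha> < \<beta> \<Longrightarrow> ord_suc \<alpha> \<le> \<beta>"
  unfolding ord_suc_def by (rule Least_le)

lemma ord_suc_inj:
  assumes "\<alpha> < ord_omega1" "\<beta> < ord_omega1" "ord_suc \<alpha> = ord_suc \<beta>"
  shows "\<alpha> = \<beta>"
  using assms less_ord_suc ord_suc_le by (metis leD linorder_neqE)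

definition is_suc_ord :: "omega1_ord \<Rightarrow> bool"
  where "is_suc_ord \<beta> \<longleftrightarrow> (\<exists>\<alpha>< ord_omega1. \<beta> = ord_suc \<alpha>)"

definition is_limit_ord :: "omega1_ord \<Rightarrow> bool"
  where "is_limit_ord \<beta> \<longleftrightarrow> \<beta> \<noteq> ord_zero \<and> \<not> is_suc_ord \<beta>"

definition ord_pred :: "omega1_ord \<Rightarrow> omega1_ord"
  where "ord_pred \<beta> = (THE \<alpha>. \<alpha> < ord_omega1 \<and> \<beta> = ord_suc \<alpha>)"

lemma ord_pred_suc: "\<alpha> < ord_omega1 \<Longrightarrow> ord_pred (ord_suc \<alpha>) = \<alpha>"
  unfolding ord_pred_def by (rule the_equality) (auto intro: ord_suc_inj)

lemma ord_pred_less: "is_suc_ord \<beta> \<Longrightarrow> ord_pred \<beta> < \<beta>"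
  unfolding is_suc_ord_def using ord_pred_suc less_ord_suc by auto


section \<open>Baire-1 functions and the oscillation index\<close>

definition baire_one_on :: "'a::metric_space set \<Rightarrow> ('a \<Rightarrow> real) \<Rightarrow> bool"
  where "baire_one_on H f \<longleftrightarrow>
    (\<exists>u :: nat \<Rightarrow> 'a \<Rightarrow> real. (\<forall>n. continuous_on H (u n)) \<and> (\<forall>x\<in>H. (\<lambda>n. u n x) \<longlonglongrightarrow> f x))"

text \<open>One derivation step. Open sets of the subspace are traces of open sets of the ambient type.\<close>

definition osc_step :: "('a::metric_space \<Rightarrow> real) \<Rightarrow> real \<Rightarrow> 'a set \<Rightarrow> 'a set"
  where "osc_step f \<epsilon> P =
    {x \<in> P. \<forall>U. open U \<and> x \<in> U \<longrightarrow> (\<exists>x1 \<in> U \<inter> P. \<exists>x2 \<in> U \<inter> P. \<bar>f x1 - f x2\<bar> \<ge> \<epsilon>)}"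

text \<open>
  \<open>osc_derived H f \<epsilon> \<alpha>\<close> is \<open>H\<^sup>\<alpha>(f, \<epsilon>)\<close>. The intersection clause also gives a value at \<open>ord_omega1\<close>,
  which the index below does not use.
\<close>

function osc_derived ::
  "'a::metric_space set \<Rightarrow> ('a \<Rightarrow> real) \<Rightarrow> real \<Rightarrow> omega1_ord \<Rightarrow> 'a set"
  where "osc_derived H f \<epsilon> \<alpha> =
    (if \<alpha> = ord_zero then H
     else if is_suc_ord \<alpha> then osc_step f \<epsilon> (osc_derived H f \<epsilon> (ord_pred \<alpha>))
     else (\<Inter>\<alpha>'\<in>{..<\<alpha>}. osc_derived H f \<epsilon> \<alpha>'))"
  by pat_completeness auto
termination
proof (relation "inv_image {(x, y). x < y} (\<lambda>(H, f, \<epsilon>, \<alpha>). \<alpha>)")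
  show "wf (inv_image {(x :: omega1_ord, y). x < y}
      (\<lambda>(H :: 'a set, f :: 'a \<Rightarrow> real, \<epsilon> :: real, \<alpha>). \<alpha>))"
    by (rule wf_inv_image) (rule wf)
qed (auto intro: ord_pred_less)

declare osc_derived.simps [simp del]

lemma osc_derived_zero: "osc_derived H f \<epsilon> ord_zero = H"
  by (simp add: osc_derived.simps)

lemma osc_derived_suc:
  assumes "\<alpha> < ord_omega1"
  shows "osc_derived H f \<epsilon> (ord_suc \<alpha>) = osc_step f \<epsilon> (osc_derived H f \<epsilon> \<alpha>)"
proof -
  have "ord_suc \<alpha> \<noteq> ord_zero" "is_suc_ord (ord_suc \<alpha>)"
    using less_ord_suc[OF assms] ord_zero_le[of \<alpha>] assms unfolding is_suc_ord_def by auto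
  then show ?thesis
    using osc_derived.simps[of H f \<epsilon> "ord_suc \<alpha>"] ord_pred_suc[OF assms] by simp
qed

lemma osc_derived_limit:
  "is_limit_ord \<alpha> \<Longrightarrow> osc_derived H f \<epsilon> \<alpha> = (\<Inter>\<alpha>'\<in>{..<\<alpha>}. osc_derived H f \<epsilon> \<alpha>')"
  unfolding is_limit_ord_def using osc_derived.simps[of H f \<epsilon> \<alpha>] by simp

definition osc_index_at :: "'a::metric_space set \<Rightarrow> ('a \<Rightarrow> real) \<Rightarrow> real \<Rightarrow> omega1_ord"
  where "osc_index_at H f \<epsilon> =
    (if \<exists>\<alpha>< ord_omega1. osc_derived H f \<epsilon> \<alpha> = {}
     then (LEAST \<alpha>. \<alpha> < ord_omega1 \<and> osc_derived H f \<epsilon> \<alpha> = {})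
     else ord_omega1)"

definition osc_index :: "'a::metric_space set \<Rightarrow> ('a \<Rightarrow> real) \<Rightarrow> omega1_ord"
  where "osc_index H f = (SUP \<epsilon>\<in>{0<..}. osc_index_at H f \<epsilon>)"

text \<open>
  The index vanishes exactly on the empty space, so an extension from an empty subspace to a
  nonempty space never has the same index.
\<close>

lemma ord_zero_less_omega1: "ord_zero < ord_omega1"
proof -
  have e: "Well_order ({} :: nat set rel)" by simp
  have "ordLeq3 (card_of ({} :: nat set set)) (cardSuc natLeq)"
    using card_of_empty1 Well_order_cardSuc_natLeq by blast
  moreover have "card_of ({} :: nat set set) = {}"
    using Field_card_of[of "{} :: nat set set"] by (auto simp: Field_def)
  ultimately show ?thesis
    unfolding ord_zero_def using less_ord_omega1_iff_countable[OF e] by simp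
qed

lemma osc_index_eq_zero_iff: "osc_index H f = ord_zero \<longleftrightarrow> H = {}"
proof
  assume 0: "osc_index H f = ord_zero"
  have "osc_index_at H f 1 \<le> osc_index H f"
    unfolding osc_index_def by (rule SUP_upper) simp
  then have z: "osc_index_at H f 1 = ord_zero"
    using 0 ord_zero_le[of "osc_index_at H f 1"] by simp
  show "H = {}"
  proof (cases "\<exists>\<alpha>. \<alpha> < ord_omega1 \<and> osc_derived H f 1 \<alpha> = {}")
    case True
    from LeastI_ex[OF True] z True show ?thesis
      by (simp add: osc_index_at_def osc_derived_zero)
  next
    case False
    then have "osc_index_at H f 1 = ord_omega1"
      unfolding osc_index_at_def by (rule if_not_P)
    then show ?thesis
      using z ord_zero_less_omega1 by simp
  qed
next
  assume "H = {}"
  have "osc_index_at H f \<epsilon> = ord_zero" for \<epsilon>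
  proof -
    have z: "ord_zero < ord_omega1 \<and> osc_derived H f \<epsilon> ord_zero = {}"
      using \<open>H = {}\<close> ord_zero_less_omega1 by (simp add: osc_derived_zero)
    then have "(LEAST \<alpha>. \<alpha> < ord_omega1 \<and> osc_derived H f \<epsilon> \<alpha> = {}) = ord_zero"
      by (rule Least_equality) (rule ord_zero_le)
    then show ?thesis using z by (auto simp: osc_index_at_def)
  qed
  then show "osc_index H f = ord_zero"
    unfolding osc_index_def by simp
qed

end

theory Submission
  imports Defs
begin

text \<open>
  The extension is produced by a linear averaging operator \<open>T\<close> of Dugundji type, which acts on
  \<^emph>\<open>all\<close> functions on the compact set \<open>F\<close>, continuous or not: \<open>T u\<close> agrees with \<open>u\<close> on \<open>F\<close>, and at a
  point \<open>y\<close> off \<open>F\<close> its value is a finite weighted average of values of \<open>u\<close> at points of \<open>F\<close> whose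
  distance from \<open>y\<close> is at most three times that of \<open>F\<close>. The weights are continuous in \<open>y\<close> and
  the same for all \<open>u\<close>. This has three consequences.

  \<^item> \<open>T u\<close> is continuous off \<open>F\<close> for every \<open>u\<close>, and everywhere if \<open>u\<close> is continuous on \<open>F\<close>. Since the
    averages are finite, \<open>T\<close> preserves pointwise limits; hence it takes Baire-1 functions to Baire-1
    functions.

  \<^item> The values of \<open>T u\<close> near a point of \<open>F\<close> are averages of nearby values of \<open>u\<close>. Averaging does not
    enlarge the diameter of a set of reals, so at points of \<open>F\<close> the oscillation of \<open>T u\<close> on
    \<open>K\<close> reaches \<open>\<epsilon>\<close> exactly where that of \<open>u\<close> on \<open>F\<close> does (\<open>osc_step_net_average\<close>).

  \<^item> Therefore the \<^emph>\<open>first\<close> derived set of \<open>K\<close> with respect to \<open>T f\<close> is exactly the first derived set of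
    \<open>F\<close> with respect to \<open>f\<close>. From there on the two derivations run through the same sets, and they
    become empty at the same stage for every \<open>\<epsilon>\<close>.
\<close>

section \<open>Averaging over finite nets\<close>

text \<open>
  In the use below \<open>N n\<close> is a finite net in \<open>F\<close> of mesh \<open>1 / (n + 1)\<close>. Write \<open>r\<close> for the distance
  of \<open>y\<close> from \<open>F\<close>. The first factor switches off the nets with \<open>n \<ge> 1 / r\<close>, so that only finitely
  many nets contribute near a given point off \<open>F\<close>, but the finest of these has mesh at most \<open>r\<close>; the
  second factor keeps only points \<open>a\<close> at a distance from \<open>y\<close> comparable to \<open>r\<close>.
\<close>

definition net_weight :: "'a::metric_space set \<Rightarrow> nat \<Rightarrow> 'a \<Rightarrow> 'a \<Rightarrow> real"
  where "net_weight F n y a =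
    max 0 (1 - real n * infdist y F) * max 0 (3 * infdist y F - dist y a)"

text \<open>The bound on \<open>n\<close> leaves out only vanishing weights, and makes the sum finite.\<close>

definition net_sum ::
  "'a::metric_space set \<Rightarrow> (nat \<Rightarrow> 'a set) \<Rightarrow> ('a \<Rightarrow> real) \<Rightarrow> 'a \<Rightarrow> real"
  where "net_sum F N u y =
    (\<Sum>n < nat \<lceil>1 / infdist y F\<rceil>. \<Sum>a\<in>N n. net_weight F n y a * u a)"

definition net_average ::
  "'a::metric_space set \<Rightarrow> (nat \<Rightarrow> 'a set) \<Rightarrow> ('a \<Rightarrow> real) \<Rightarrow> 'a \<Rightarrow> real"
  where "net_average F N u y =
    (if y \<in> F then u y else net_sum F N u y / net_sum F N (\<lambda>_. 1) y)"

lemma net_average_in: "y \<in> F \<Longrightarrow> net_average F N u y = u y"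
  by (simp add: net_average_def)

lemma net_weight_nonneg: "0 \<le> net_weight F n y a"
  by (simp add: net_weight_def)

lemma net_sum_eq:
  assumes "0 < infdist y F" "1 / infdist y F \<le> real M"
  shows "net_sum F N u y = (\<Sum>n<M. \<Sum>a\<in>N n. net_weight F n y a * u a)"
  unfolding net_sum_def
proof (rule sum.mono_neutral_left)
  show "{..<nat \<lceil>1 / infdist y F\<rceil>} \<subseteq> {..<M}"
    using assms(2) by (simp add: nat_le_iff ceiling_le_iff)
  show "\<forall>n\<in>{..<M} - {..<nat \<lceil>1 / infdist y F\<rceil>}. (\<Sum>a\<in>N n. net_weight F n y a * u a) = 0"
  proof
    fix n assume "n \<in> {..<M} - {..<nat \<lceil>1 / infdist y F\<rceil>}"
    then have "1 / infdist y F \<le> real n"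
      by (simp add: nat_le_iff ceiling_le_iff)
    then have "1 \<le> real n * infdist y F"
      using assms(1) by (simp add: field_simps)
    then show "(\<Sum>a\<in>N n. net_weight F n y a * u a) = 0"
      by (simp add: net_weight_def)
  qed
qed simp

text \<open>
  The number of nets that contribute is locally bounded off \<open>F\<close>, so \<open>net_sum\<close> is there locally a
  fixed finite sum of continuous functions, in which \<open>u\<close> occurs only through its values at the points
  of the nets, that is, as coefficients.
\<close>

lemma isCont_net_sum:
  assumes "0 < infdist y F"
  shows "isCont (net_sum F N u) y"
proof -
  define M where "M = nat \<lceil>2 / infdist y F\<rceil>"
  have "((\<lambda>z. infdist z F) \<longlongrightarrow> infdist y F) (nhds y)"
    by (intro tendsto_intros filterlim_ident)
  then have "\<forall>\<^sub>F z in nhds y. infdist y F / 2 < infdist z F"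
    by (rule order_tendstoD(1)) (use assms in linarith)
  then have "\<forall>\<^sub>F z in nhds y. net_sum F N u z = (\<Sum>n<M. \<Sum>a\<in>N n. net_weight F n z a * u a)"
  proof eventually_elim
    case (elim z)
    then have "1 / infdist z F \<le> 2 / infdist y F"
      using assms by (simp add: field_simps)
    also have "\<dots> \<le> real M"
      unfolding M_def by linarith
    finally show ?case
      using elim assms by (intro net_sum_eq) auto
  qed
  moreover have "isCont (\<lambda>z. \<Sum>n<M. \<Sum>a\<in>N n. net_weight F n z a * u a) y"
    unfolding net_weight_def by (intro continuous_intros)
  ultimately show ?thesis
    by (simp add: isCont_cong)
qed

text \<open>
  The finest net that is not switched off at \<open>y\<close> has mesh at most the distance \<open>r\<close> of \<open>y\<close> from \<open>F\<close>.
  So it has a point at distance less than \<open>3 * r\<close> from \<open>y\<close>, and the weight of this point is positive.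
\<close>

lemma net_sum_one_pos:
  assumes fin: "\<And>n. finite (N n)"
    and cover: "\<And>n. F \<subseteq> (\<Union>a\<in>N n. ball a (1 / real (Suc n)))"
    and F: "compact F" "F \<noteq> {}" and y: "y \<notin> F"
  shows "0 < net_sum F N (\<lambda>_. 1) y"
proof -
  let ?r = "infdist y F"
  let ?M = "nat \<lceil>1 / ?r\<rceil>"
  have r: "0 < ?r"
    using infdist_pos_not_in_closed[OF compact_imp_closed] F y by blast
  \<comment> \<open>The largest \<open>n\<close> whose net is not switched off at \<open>y\<close>.\<close>
  define n where "n = ?M - 1"
  have M: "0 < ?M" "1 / ?r \<le> real ?M" "real ?M < 1 / ?r + 1"
    using r by (simp, linarith, simp) linarith
  then have "real n < 1 / ?r" "1 / ?r \<le> real (Suc n)"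
    unfolding n_def by linarith+
  then have n: "real n * ?r < 1" "1 / real (Suc n) \<le> ?r"
    using r by (simp_all add: field_simps)
  have "?r < 2 * ?r"
    using r by simp
  then obtain b where b: "b \<in> F" "dist y b < 2 * ?r"
    using F(2) by (auto simp: infdist_notempty cINF_less_iff)
  then obtain a where a: "a \<in> N n" "dist a b < 1 / real (Suc n)"
    using cover[of n] by auto
  have "dist y a \<le> dist y b + dist a b"
    by (rule dist_triangle2)
  then have "dist y a < 3 * ?r"
    using a(2) b(2) n(2) r by linarith
  then have "0 < net_weight F n y a"
    using n(1) by (simp add: net_weight_def)
  then have "0 < (\<Sum>a\<in>N n. net_weight F n y a * 1)"
    using a(1) fin by (auto intro!: sum_pos2[of _ a] net_weight_nonneg)
  then show ?thesis
    unfolding net_sum_def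
    by (rule sum_pos2[of _ n, rotated 2]) (use M(1) in \<open>auto simp: n_def intro!: sum_nonneg net_weight_nonneg\<close>)
qed

text \<open>
  An average of numbers in an open interval lies in that interval. For \<open>y \<in> F\<close> the hypothesis
  concerns only the point \<open>y\<close> itself, which lets one estimate cover both kinds of points.
\<close>

lemma net_average_near:
  assumes fin: "\<And>n. finite (N n)" and sub: "\<And>n. N n \<subseteq> F"
    and cover: "\<And>n. F \<subseteq> (\<Union>a\<in>N n. ball a (1 / real (Suc n)))"
    and F: "compact F" "F \<noteq> {}"
    and near: "\<And>a. a \<in> F \<Longrightarrow> dist y a \<le> 3 * infdist y F \<Longrightarrow> \<bar>u a - c\<bar> < e"
  shows "\<bar>net_average F N u y - c\<bar> < e"
proof (cases "y \<in> F")
  case True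
  then show ?thesis
    using near[of y] by (simp add: net_average_in)
next
  case False
  let ?w = "\<lambda>n. net_weight F n y"
  let ?M = "nat \<lceil>1 / infdist y F\<rceil>"
  let ?W = "net_sum F N (\<lambda>_. 1) y"
  have pos: "0 < ?W"
    by (rule net_sum_one_pos[OF fin cover F False])
  \<comment> \<open>Only finitely many points occur, so the strict bound \<open>e\<close> can be improved to some \<open>d < e\<close>.\<close>
  define A where "A = (\<Union>n<?M. {a \<in> N n. ?w n a \<noteq> 0})"
  have "finite A"
    unfolding A_def using fin by simp
  have w0: "dist y a \<le> 3 * infdist y F" if "?w n a \<noteq> 0" for n a
    using that by (auto simp: net_weight_def max_def split: if_splits)
  have A: "\<bar>u a - c\<bar> < e" if "a \<in> A" for a
    using that near[of a] sub w0 unfolding A_def by blast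
  have "A \<noteq> {}"
  proof
    assume "A = {}"
    then have "?W = 0"
      unfolding net_sum_def A_def by (intro sum.neutral ballI) auto
    with pos show False by simp
  qed
  define d where "d = Max ((\<lambda>a. \<bar>u a - c\<bar>) ` A)"
  have d: "d < e" "\<And>a. a \<in> A \<Longrightarrow> \<bar>u a - c\<bar> \<le> d"
    unfolding d_def using \<open>finite A\<close> \<open>A \<noteq> {}\<close> A by auto
  have bound: "\<bar>?w n a * u a - ?w n a * c\<bar> \<le> ?w n a * d" if "n < ?M" "a \<in> N n" for n a
  proof (cases "?w n a = 0")
    case False
    then have "\<bar>u a - c\<bar> \<le> d"
      using d(2) that unfolding A_def by blast
    then have "?w n a * \<bar>u a - c\<bar> \<le> ?w n a * d"
      by (rule mult_left_mono) (rule net_weight_nonneg)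
    then show ?thesis
      using net_weight_nonneg[of F n y a]
      by (simp add: right_diff_distrib[symmetric] abs_mult)
  qed simp
  have "\<bar>net_sum F N u y - ?W * c\<bar>
      = \<bar>\<Sum>n<?M. \<Sum>a\<in>N n. (?w n a * u a - ?w n a * c)\<bar>"
    by (simp add: net_sum_def sum_subtractf sum_distrib_right)
  also have "\<dots> \<le> (\<Sum>n<?M. \<Sum>a\<in>N n. ?w n a * d)"
    by (intro order_trans[OF sum_abs] sum_mono) (use bound in auto)
  also have "\<dots> = ?W * d"
    by (simp add: net_sum_def sum_distrib_right)
  finally have "\<bar>net_sum F N u y - ?W * c\<bar> \<le> ?W * d" .
  moreover have "net_average F N u y - c = (net_sum F N u y - ?W * c) / ?W"
    using False pos by (simp add: net_average_def diff_divide_distrib)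
  ultimately have "\<bar>net_average F N u y - c\<bar> \<le> d"
    using pos by (simp add: divide_le_eq mult.commute)
  then show ?thesis
    using d(1) by simp
qed

lemma isCont_net_average_off:
  assumes fin: "\<And>n. finite (N n)"
    and cover: "\<And>n. F \<subseteq> (\<Union>a\<in>N n. ball a (1 / real (Suc n)))"
    and F: "compact F" "F \<noteq> {}" and y: "y \<notin> F"
  shows "isCont (net_average F N u) y"
proof -
  have r: "0 < infdist y F"
    using infdist_pos_not_in_closed[OF compact_imp_closed] F y by blast
  have "open (- F)"
    using F(1) compact_imp_closed by blast
  then have "\<forall>\<^sub>F z in nhds y. z \<in> - F"
    using y by (intro eventually_nhds_in_open) auto
  then have "\<forall>\<^sub>F z in nhds y.
      net_average F N u z = net_sum F N u z / net_sum F N (\<lambda>_. 1) z"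
    by eventually_elim (simp add: net_average_def)
  moreover have "isCont (\<lambda>z. net_sum F N u z / net_sum F N (\<lambda>_. 1) z) y"
    using net_sum_one_pos[OF fin cover F y]
    by (intro isCont_divide isCont_net_sum r) simp
  ultimately show ?thesis
    by (simp add: isCont_cong)
qed

text \<open>
  The points of \<open>F\<close> that enter the average at \<open>y\<close> are at most four times as far from a point \<open>x\<close> of
  \<open>F\<close> as \<open>y\<close> is: this is how bounds for \<open>u\<close> near \<open>x\<close> pass to the averages near \<open>x\<close>.
\<close>

lemma dist_near_net_point:
  assumes "x \<in> F" "dist x y < \<delta> / 4" "dist y a \<le> 3 * infdist y F"
  shows "dist x a < \<delta>"
proof -
  have "infdist y F \<le> dist x y"
    using infdist_le[OF assms(1), of y] by (simp add: dist_commute)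
  then show ?thesis
    using assms dist_triangle[of x a y] by linarith
qed

lemma continuous_net_average:
  assumes fin: "\<And>n. finite (N n)" and sub: "\<And>n. N n \<subseteq> F"
    and cover: "\<And>n. F \<subseteq> (\<Union>a\<in>N n. ball a (1 / real (Suc n)))"
    and F: "compact F" "F \<noteq> {}" and u: "continuous_on F u"
  shows "continuous_on K (net_average F N u)"
proof (rule continuous_at_imp_continuous_on, rule ballI)
  fix x assume "x \<in> K"
  show "isCont (net_average F N u) x"
  proof (cases "x \<in> F")
    case True
    show ?thesis
      unfolding continuous_at_eps_delta
    proof (intro allI impI)
      fix e :: real assume "0 < e"
      then obtain \<delta> where \<delta>: "0 < \<delta>" "\<And>a. a \<in> F \<Longrightarrow> dist a x < \<delta> \<Longrightarrow> dist (u a) (u x) < e"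
        using u True unfolding continuous_on_iff by meson
      have "dist (net_average F N u y) (net_average F N u x) < e" if "dist y x < \<delta> / 4" for y
      proof -
        have "\<bar>net_average F N u y - u x\<bar> < e"
        proof (rule net_average_near[OF fin sub cover F])
          fix a assume "a \<in> F" "dist y a \<le> 3 * infdist y F"
          then show "\<bar>u a - u x\<bar> < e"
            using \<delta>(2)[of a] dist_near_net_point[OF True, of y \<delta> a] that
            by (simp add: dist_commute dist_real_def abs_minus_commute)
        qed
        then show ?thesis
          using True by (simp add: net_average_in dist_real_def)
      qed
      then show "\<exists>d>0. \<forall>y. dist y x < d \<longrightarrow>
          dist (net_average F N u y) (net_average F N u x) < e"
        using \<delta>(1) by (intro exI[of _ "\<delta> / 4"]) auto
    qed
  qed (rule isCont_net_average_off[OF fin cover F])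
qed

lemma tendsto_net_average:
  assumes fin: "\<And>n. finite (N n)" and sub: "\<And>n. N n \<subseteq> F"
    and cover: "\<And>n. F \<subseteq> (\<Union>a\<in>N n. ball a (1 / real (Suc n)))"
    and F: "compact F" "F \<noteq> {}"
    and lim: "\<And>x. x \<in> F \<Longrightarrow> (\<lambda>k. u k x) \<longlonglongrightarrow> f x"
  shows "(\<lambda>k. net_average F N (u k) y) \<longlonglongrightarrow> net_average F N f y"
proof (cases "y \<in> F")
  case True
  then show ?thesis
    using lim by (simp add: net_average_in)
next
  case False
  have "(\<lambda>k. net_sum F N (u k) y) \<longlonglongrightarrow> net_sum F N f y"
    unfolding net_sum_def using lim sub by (intro tendsto_intros) blast
  then show ?thesis
    using False net_sum_one_pos[OF fin cover F False]
    by (simp add: net_average_def tendsto_divide)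
qed

lemma baire_one_on_net_average:
  assumes fin: "\<And>n. finite (N n)" and sub: "\<And>n. N n \<subseteq> F"
    and cover: "\<And>n. F \<subseteq> (\<Union>a\<in>N n. ball a (1 / real (Suc n)))"
    and F: "compact F" "F \<noteq> {}" and f: "baire_one_on F f"
  shows "baire_one_on K (net_average F N f)"
proof -
  obtain u where u: "\<And>k. continuous_on F (u k)" "\<And>x. x \<in> F \<Longrightarrow> (\<lambda>k. u k x) \<longlonglongrightarrow> f x"
    using f unfolding baire_one_on_def by blast
  show ?thesis
    unfolding baire_one_on_def
  proof (intro exI conjI allI ballI)
    show "continuous_on K (net_average F N (u k))" for k
      by (rule continuous_net_average[OF fin sub cover F u(1)])
    show "(\<lambda>k. net_average F N (u k) y) \<longlonglongrightarrow> net_average F N f y" for y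
      by (rule tendsto_net_average[OF fin sub cover F u(2)])
  qed
qed


section \<open>Comparison of the derivations\<close>

text \<open>
  Off \<open>F\<close> the averaged function is continuous. At a point of \<open>F\<close>, if all values of \<open>f\<close> near it
  differ by less than \<open>\<epsilon>\<close>, then the same holds for averages of these values: first one and then the
  other of two values of \<open>f\<close> is replaced by an average.
\<close>

lemma osc_step_net_average:
  assumes fin: "\<And>n. finite (N n)" and sub: "\<And>n. N n \<subseteq> F"
    and cover: "\<And>n. F \<subseteq> (\<Union>a\<in>N n. ball a (1 / real (Suc n)))"
    and F: "compact F" "F \<noteq> {}" and FK: "F \<subseteq> K" and \<epsilon>: "0 < \<epsilon>"
  shows "osc_step (net_average F N f) \<epsilon> K = osc_step f \<epsilon> F"
proof (intro equalityI subsetI)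
  let ?g = "net_average F N f"
  fix x assume x: "x \<in> osc_step f \<epsilon> F"
  have "\<exists>x1 \<in> U \<inter> K. \<exists>x2 \<in> U \<inter> K. \<bar>?g x1 - ?g x2\<bar> \<ge> \<epsilon>" if U: "open U" "x \<in> U" for U
  proof -
    obtain x1 x2 where "x1 \<in> U \<inter> F" "x2 \<in> U \<inter> F" "\<bar>f x1 - f x2\<bar> \<ge> \<epsilon>"
      using x U unfolding osc_step_def by blast
    then show ?thesis
      using FK by (intro bexI[of _ x1] bexI[of _ x2]) (auto simp: net_average_in)
  qed
  then show "x \<in> osc_step ?g \<epsilon> K"
    using x FK unfolding osc_step_def by blast
next
  let ?g = "net_average F N f"
  fix x assume x: "x \<in> osc_step ?g \<epsilon> K"
  have large: "\<exists>x1 \<in> ball x \<delta>. \<exists>x2 \<in> ball x \<delta>. \<bar>?g x1 - ?g x2\<bar> \<ge> \<epsilon>" if "0 < \<delta>" for \<delta>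
  proof -
    have "open (ball x \<delta>) \<and> x \<in> ball x \<delta>"
      using that by simp
    then show ?thesis
      using x unfolding osc_step_def by blast
  qed
  have xF: "x \<in> F"
  proof (rule ccontr)
    assume "x \<notin> F"
    then have "isCont ?g x"
      by (rule isCont_net_average_off[OF fin cover F])
    then obtain \<delta> where "0 < \<delta>" and \<delta>: "\<And>y. dist y x < \<delta> \<Longrightarrow> dist (?g y) (?g x) < \<epsilon> / 2"
      unfolding continuous_at_eps_delta using \<epsilon> by (meson half_gt_zero)
    obtain x1 x2 where 12: "dist x1 x < \<delta>" "dist x2 x < \<delta>" "\<bar>?g x1 - ?g x2\<bar> \<ge> \<epsilon>"
      using large[OF \<open>0 < \<delta>\<close>] by (auto simp: dist_commute)
    then show False
      using \<delta>[of x1] \<delta>[of x2] unfolding dist_real_def by linarith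
  qed
  have "\<exists>x1 \<in> U \<inter> F. \<exists>x2 \<in> U \<inter> F. \<bar>f x1 - f x2\<bar> \<ge> \<epsilon>" if U: "open U" "x \<in> U" for U
  proof (rule ccontr)
    assume "\<not> ?thesis"
    then have small: "\<bar>f a - f b\<bar> < \<epsilon>" if "a \<in> U \<inter> F" "b \<in> U \<inter> F" for a b
      using that by force
    obtain \<delta> where "0 < \<delta>" and \<delta>: "ball x \<delta> \<subseteq> U"
      using U open_contains_ball by blast
    obtain x1 x2 where 12: "dist x x1 < \<delta> / 4" "dist x x2 < \<delta> / 4" "\<bar>?g x1 - ?g x2\<bar> \<ge> \<epsilon>"
      using large[of "\<delta> / 4"] \<open>0 < \<delta>\<close> by auto
    have inU: "a \<in> U" if "dist x y < \<delta> / 4" "dist y a \<le> 3 * infdist y F" for a y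
      using dist_near_net_point[OF xF that] \<delta> by auto
    have 1: "\<bar>?g x1 - f b\<bar> < \<epsilon>" if b: "b \<in> U \<inter> F" for b
    proof (rule net_average_near[OF fin sub cover F])
      fix a assume "a \<in> F" "dist x1 a \<le> 3 * infdist x1 F"
      then show "\<bar>f a - f b\<bar> < \<epsilon>"
        using inU[OF 12(1)] small b by blast
    qed
    have "\<bar>?g x2 - ?g x1\<bar> < \<epsilon>"
    proof (rule net_average_near[OF fin sub cover F])
      fix b assume "b \<in> F" "dist x2 b \<le> 3 * infdist x2 F"
      then show "\<bar>f b - ?g x1\<bar> < \<epsilon>"
        using inU[OF 12(2)] 1[of b] by (simp add: abs_minus_commute)
    qed
    then show False
      using 12(3) by (simp add: abs_minus_commute)
  qed
  then show "x \<in> osc_step f \<epsilon> F"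
    using xF unfolding osc_step_def by blast
qed

lemma osc_step_subset: "osc_step f \<epsilon> P \<subseteq> P"
  unfolding osc_step_def by blast

lemma osc_step_cong:
  assumes "\<And>x. x \<in> P \<Longrightarrow> f x = g x"
  shows "osc_step f \<epsilon> P = osc_step g \<epsilon> P"
  unfolding osc_step_def using assms by auto

lemma ord_cases:
  obtains (zero) "\<alpha> = ord_zero"
    | (suc) \<beta> where "\<beta> < ord_omega1" "\<alpha> = ord_suc \<beta>" "\<beta> < \<alpha>"
    | (limit) "is_limit_ord \<alpha>" "ord_zero < \<alpha>" "ord_suc ord_zero < \<alpha>"
proof (cases "\<alpha> = ord_zero \<or> is_suc_ord \<alpha>")
  case True
  then show ?thesis
    using zero suc less_ord_suc unfolding is_suc_ord_def by blast
next
  case False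
  then have 0: "ord_zero < \<alpha>"
    using ord_zero_le[of \<alpha>] by auto
  moreover have "ord_suc ord_zero \<noteq> \<alpha>"
    using False ord_zero_less_omega1 unfolding is_suc_ord_def by blast
  ultimately have "ord_suc ord_zero < \<alpha>"
    using ord_suc_le[OF 0] by simp
  then show ?thesis
    using limit 0 False unfolding is_limit_ord_def by blast
qed

lemma osc_derived_subset: "osc_derived H f \<epsilon> \<alpha> \<subseteq> H"
proof (induction \<alpha> rule: less_induct)
  case (less \<alpha>)
  show ?case
  proof (cases \<alpha> rule: ord_cases)
    case (suc \<beta>)
    then show ?thesis
      using less[of \<beta>] osc_step_subset by (fastforce simp: osc_derived_suc)
  next
    case limit
    then show ?thesis
      using less[of ord_zero] by (auto simp: osc_derived_limit)
  qed (simp add: osc_derived_zero)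
qed

text \<open>
  The stage \<open>ord_zero\<close> has to be left out, because there the sets are \<open>K\<close> and \<open>F\<close>. At a limit stage
  it contributes \<open>K\<close> to one intersection and \<open>F\<close> to the other; both can be disregarded, as the
  first derived sets are contained in \<open>F\<close> and \<open>F\<close> in \<open>K\<close>.
\<close>

lemma osc_derived_eq_if_osc_step_eq:
  assumes first: "osc_step g \<epsilon> K = osc_step f \<epsilon> F"
    and ext: "\<And>x. x \<in> F \<Longrightarrow> g x = f x" and FK: "F \<subseteq> K"
  shows "\<alpha> \<noteq> ord_zero \<Longrightarrow> osc_derived K g \<epsilon> \<alpha> = osc_derived F f \<epsilon> \<alpha>"
proof (induction \<alpha> rule: less_induct)
  case (less \<alpha>)
  show ?case
  proof (cases \<alpha> rule: ord_cases)
    case zero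
    with less show ?thesis by simp
  next
    case (suc \<beta>)
    show ?thesis
    proof (cases "\<beta> = ord_zero")
      case True
      with suc first show ?thesis
        by (simp add: osc_derived_suc osc_derived_zero)
    next
      case False
      with suc less.IH have "osc_derived K g \<epsilon> \<beta> = osc_derived F f \<epsilon> \<beta>"
        by blast
      moreover have "osc_step g \<epsilon> (osc_derived F f \<epsilon> \<beta>) = osc_step f \<epsilon> (osc_derived F f \<epsilon> \<beta>)"
        using ext osc_derived_subset by (intro osc_step_cong) blast
      ultimately show ?thesis
        using suc by (simp add: osc_derived_suc)
    qed
  next
    case limit
    let ?one = "ord_suc ord_zero"
    have "?one \<noteq> ord_zero"
      using less_ord_suc[OF ord_zero_less_omega1] by auto
    then have "osc_derived K g \<epsilon> ?one = osc_derived F f \<epsilon> ?one"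
      using less.IH limit by blast
    then have one: "osc_derived K g \<epsilon> ?one \<subseteq> F"
      using osc_derived_subset by blast
    have eq: "(\<Inter>\<alpha>'\<in>{..<\<alpha>}. osc_derived K g \<epsilon> \<alpha>') = (\<Inter>\<alpha>'\<in>{..<\<alpha>}. osc_derived F f \<epsilon> \<alpha>')"
    proof (intro equalityI subsetI INT_I)
      fix x \<alpha>' assume "x \<in> (\<Inter>\<alpha>'\<in>{..<\<alpha>}. osc_derived K g \<epsilon> \<alpha>')" "\<alpha>' \<in> {..<\<alpha>}"
      then show "x \<in> osc_derived F f \<epsilon> \<alpha>'"
        using less.IH[of \<alpha>'] one limit by (cases "\<alpha>' = ord_zero") (auto simp: osc_derived_zero)
    next
      fix x \<alpha>' assume "x \<in> (\<Inter>\<alpha>'\<in>{..<\<alpha>}. osc_derived F f \<epsilon> \<alpha>')" "\<alpha>' \<in> {..<\<alpha>}"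
      moreover from this have "x \<in> F"
        using osc_derived_subset[of F f \<epsilon> \<alpha>'] by blast
      ultimately show "x \<in> osc_derived K g \<epsilon> \<alpha>'"
        using less.IH[of \<alpha>'] FK by (cases "\<alpha>' = ord_zero") (auto simp: osc_derived_zero)
    qed
    show ?thesis
      using eq limit by (simp only: osc_derived_limit)
  qed
qed

lemma osc_index_eq_if_osc_step_eq:
  assumes first: "\<And>\<epsilon>. 0 < \<epsilon> \<Longrightarrow> osc_step g \<epsilon> K = osc_step f \<epsilon> F"
    and ext: "\<And>x. x \<in> F \<Longrightarrow> g x = f x" and FK: "F \<subseteq> K" and empty: "F = {} \<Longrightarrow> K = {}"
  shows "osc_index K g = osc_index F f"
proof -
  have "osc_index_at K g \<epsilon> = osc_index_at F f \<epsilon>" if "0 < \<epsilon>" for \<epsilon>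
  proof -
    have "osc_derived K g \<epsilon> \<alpha> = {} \<longleftrightarrow> osc_derived F f \<epsilon> \<alpha> = {}" for \<alpha>
    proof (cases "\<alpha> = ord_zero")
      case True
      then show ?thesis
        using FK empty by (auto simp: osc_derived_zero)
    next
      case False
      then show ?thesis
        using osc_derived_eq_if_osc_step_eq[OF first[OF that] ext FK] by simp
    qed
    then show ?thesis
      unfolding osc_index_at_def by (simp only:)
  qed
  then show ?thesis
    unfolding osc_index_def by (intro SUP_cong) auto
qed

theorem theorem3p6:
  fixes K F :: "'a::metric_space set" and f :: "'a \<Rightarrow> real"
  assumes "compact K"
    and "closedin (top_of_set K) F"
    and "F = {} \<longrightarrow> K = {}"
    and "baire_one_on F f"
  shows "\<exists>g :: 'a \<Rightarrow> real. baire_one_on K g \<and> (\<forall>x\<in>F. g x = f x) \<and> osc_index K g = osc_index F f"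
proof (cases "F = {}")
  case True
  with assms show ?thesis by auto
next
  case False
  have F: "compact F" "F \<subseteq> K"
    using assms(1,2) closedin_compact closedin_imp_subset by blast+
  have "\<exists>A. finite A \<and> A \<subseteq> F \<and> F \<subseteq> (\<Union>a\<in>A. ball a (1 / real (Suc n)))" for n
    using seq_compact_imp_totally_bounded[OF compact_imp_seq_compact[OF F(1)]] by simp
  then obtain N where fin: "\<And>n. finite (N n)" and sub: "\<And>n. N n \<subseteq> F"
    and cover: "\<And>n. F \<subseteq> (\<Union>a\<in>N n. ball a (1 / real (Suc n)))"
    by metis
  let ?g = "net_average F N f"
  have ext: "?g x = f x" if "x \<in> F" for x
    using that by (rule net_average_in)
  moreover have "baire_one_on K ?g"
    by (rule baire_one_on_net_average[OF fin sub cover F(1) False assms(4)])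
  moreover have "osc_index K ?g = osc_index F f"
    using osc_step_net_average[OF fin sub cover F(1) False F(2)] ext F(2) False
    by (intro osc_index_eq_if_osc_step_eq) auto
  ultimately show ?thesis by blast
qed

end
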